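(* Let $G=([n],E)$ be a directed acyclic graph whose nodes are labeled so that $j\to i\in E$ implies $j<i$, let $w\in\mathbb{R}^E$, and let $C\in\mathbb{T}^{n\times n}$ be its weighted adjacency matrix ($c_{ij}=w(j\to i)$ if $j\to i\in E$, $c_{ii}=0$, $c_{ij}=\infty$ otherwise), with columns $c^{(1)},\dots,c^{(n)}$. Let $L$ be the perfect matching $\{(j,j) : j\in[n]\}$ in the support graph of $C$. Then $\operatorname{tconv}(C^\star)\subseteq\operatorname{tconv}(C)$, and the polytrope $\operatorname{tconv}(C^\star)$ coincides with the closed covector cell $S_L(C)=\bigcap_{j=1}^n S_j(c^{(j)})$.
   Context: Work over the min-plus tropical semiring $\mathbb{T}=\mathbb{R}\cup\{\infty\}$ with $a\oplus b=\min(a,b)$ and $a\odot b=a+b$. The tropical affine space is $\mathbb{TA}^{d-1}=\mathbb{R}^d/\mathbb{R}\mathbf{1}$. The Kleene star of $C\in\mathbb{T}^{n\times n}$ (for $C$ as in the claim) is $C^\star=I\oplus C\oplus C^{\odot 2}\oplus\cdots\oplus C^{\odot(n-1)}$, where $I$ has $0$ on the diagonal and $\infty$ elsewhere and matrix operations are min-plus; equivalently $c^\star_{ij}$ is the minimum total weight of a directed path from $j$ to $i$ ($0$ if $i=j$, $\infty$ if there is none). For $V\in\mathbb{T}^{d\times n}$ such that every row and every column has a finite entry, $\operatorname{tconv}(V)=\{V\odot\lambda : \lambda\in\mathbb{R}^n\}\subseteq\mathbb{TA}^{d-1}$, where $(V\odot\lambda)_i=\min_j(v_{ij}+\lambda_j)$.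 For $v=(v_1,\dots,v_d)\in\mathbb{T}^d$ not all $\infty$, let $\alpha_v(x)=\max\{x_\ell-v_\ell : v_\ell\neq\infty\}$ (max-tropical linear form with apex $v$); for $i$ with $v_i\neq\infty$ the closed cell is $S_i(v)=\{x\in\mathbb{TA}^{d-1} : x_i-v_i=\alpha_v(x)\}$. For a point configuration $V$ with columns $v^{(1)},\dots,v^{(n)}$, the support graph is the bipartite graph on $[n]\sqcup[d]$ with an edge $(j,i)$ iff $v^{(j)}_i\neq\infty$; for a subgraph $L$ of it, the closed covector cell is $S_L(V)=\bigcap_{(j,i)\in L}S_i(v^{(j)})$. A polytrope is a tropical polyhedron $\operatorname{tconv}(V)$ that is also classically convex. *)

theory Defs
  imports "HOL-Analysis.Analysis"
begin

section \<open>Min-plus linear algebra\<close>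

text \<open>
  The tropical numbers \<open>\<real> \<union> {\<infinity>}\<close> are represented in \<^typ>\<open>ereal\<close>. The value \<open>-\<infinity>\<close> is not a
  tropical number; it is excluded in \<open>point_configuration\<close> and never arises as an entry of
  a weighted adjacency matrix or of a min-plus product of such matrices.
  A \<open>d \<times> n\<close> matrix has type \<^typ>\<open>ereal ^ 'n ^ 'd\<close>, so \<open>A $ i $ j\<close> is the entry in row \<open>i\<close>
  and column \<open>j\<close>.
\<close>

definition trop_mat_mult :: "ereal ^ 'm ^ 'd \<Rightarrow> ereal ^ 'n ^ 'm \<Rightarrow> ereal ^ 'n ^ 'd"  (infixl \<open>\<odot>\<close> 70)
  where "A \<odot> B = (\<chi> i j. MIN k. A $ i $ k + B $ k $ j)"

definition trop_mat_vec :: "ereal ^ 'n ^ 'd \<Rightarrow> ereal ^ 'n \<Rightarrow> ereal ^ 'd"  (infixl \<open>\<odot>v\<close> 70)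
  where "A \<odot>v x = (\<chi> i. MIN j. A $ i $ j + x $ j)"

definition trop_id :: "ereal ^ 'n ^ 'n"
  where "trop_id = (\<chi> i j. if i = j then 0 else \<infinity>)"

primrec trop_mat_power :: "ereal ^ 'n ^ 'n \<Rightarrow> nat \<Rightarrow> ereal ^ 'n ^ 'n" where
  "trop_mat_power A 0 = trop_id"
| "trop_mat_power A (Suc k) = A \<odot> trop_mat_power A k"

definition kleene_star :: "ereal ^ 'n ^ 'n \<Rightarrow> ereal ^ 'n ^ 'n"
  where "kleene_star A = (\<chi> i j. MIN k\<in>{..CARD('n) - 1}. trop_mat_power A k $ i $ j)"

definition weighted_adjacency :: "('n \<times> 'n) set \<Rightarrow> ('n \<times> 'n \<Rightarrow> real) \<Rightarrow> ereal ^ 'n ^ 'n"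
  where "weighted_adjacency E w =
    (\<chi> i j. if (j, i) \<in> E then ereal (w (j, i)) else if i = j then 0 else \<infinity>)"


section \<open>The tropical affine space\<close>

definition trop_equiv :: "real ^ 'd \<Rightarrow> real ^ 'd \<Rightarrow> bool"
  where "trop_equiv x y \<longleftrightarrow> (\<exists>c. y = x + c *\<^sub>R 1)"

lemma trop_equivI: "y = x + c *\<^sub>R 1 \<Longrightarrow> trop_equiv x y"
  unfolding trop_equiv_def by blast

lemma equivp_trop_equiv: "equivp (trop_equiv :: real ^ 'a \<Rightarrow> _)"
proof (rule equivpI)
  show "reflp (trop_equiv :: real ^ 'a \<Rightarrow> _)"
    by (rule reflpI, rule trop_equivI[where c = 0]) simp
  show "symp (trop_equiv :: real ^ 'a \<Rightarrow> _)"
  proof (rule sympI)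
    fix x y :: "real ^ 'a"
    assume "trop_equiv x y"
    then obtain c where "y = x + c *\<^sub>R 1" unfolding trop_equiv_def by blast
    then show "trop_equiv y x" by (intro trop_equivI[where c = "- c"]) simp
  qed
  show "transp (trop_equiv :: real ^ 'a \<Rightarrow> _)"
  proof (rule transpI)
    fix x y z :: "real ^ 'a"
    assume "trop_equiv x y" "trop_equiv y z"
    then obtain c c' where "y = x + c *\<^sub>R 1" "z = y + c' *\<^sub>R 1"
      unfolding trop_equiv_def by blast
    then show "trop_equiv x z"
      by (intro trop_equivI[where c = "c + c'"]) (simp add: scaleR_add_left)
  qed
qed

quotient_type 'd tropical_affine = "real ^ 'd::finite" / trop_equiv
  by (rule equivp_trop_equiv)

lift_definition trop_proj :: "real ^ 'd \<Rightarrow> 'd tropical_affine" is "\<lambda>x. x" .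

text \<open>
  The quotient vector space structure, so that \<^const>\<open>convex\<close> on \<^typ>\<open>'d tropical_affine\<close>
  is classical convexity.
\<close>

instantiation tropical_affine :: (finite) real_vector
begin

lift_definition zero_tropical_affine :: "'a tropical_affine" is 0 .

lift_definition plus_tropical_affine ::
  "'a tropical_affine \<Rightarrow> 'a tropical_affine \<Rightarrow> 'a tropical_affine" is "(+)"
proof -
  fix x y u v :: "real ^ 'a"
  assume "trop_equiv x y" "trop_equiv u v"
  then obtain c c' where "y = x + c *\<^sub>R 1" "v = u + c' *\<^sub>R 1"
    unfolding trop_equiv_def by blast
  then show "trop_equiv (x + u) (y + v)"
    by (intro trop_equivI[where c = "c + c'"]) (simp add: scaleR_add_left)
qed

lift_definition uminus_tropical_affine :: "'a tropical_affine \<Rightarrow> 'a tropical_affine" is uminus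
proof -
  fix x y :: "real ^ 'a"
  assume "trop_equiv x y"
  then obtain c where "y = x + c *\<^sub>R 1" unfolding trop_equiv_def by blast
  then show "trop_equiv (- x) (- y)" by (intro trop_equivI[where c = "- c"]) simp
qed

lift_definition minus_tropical_affine ::
  "'a tropical_affine \<Rightarrow> 'a tropical_affine \<Rightarrow> 'a tropical_affine" is "(-)"
proof -
  fix x y u v :: "real ^ 'a"
  assume "trop_equiv x y" "trop_equiv u v"
  then obtain c c' where "y = x + c *\<^sub>R 1" "v = u + c' *\<^sub>R 1"
    unfolding trop_equiv_def by blast
  then show "trop_equiv (x - u) (y - v)"
    by (intro trop_equivI[where c = "c - c'"]) (simp add: scaleR_diff_left)
qed

lift_definition scaleR_tropical_affine :: "real \<Rightarrow> 'a tropical_affine \<Rightarrow> 'a tropical_affine"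
  is "(*\<^sub>R)"
proof -
  fix r :: real and x y :: "real ^ 'a"
  assume "trop_equiv x y"
  then obtain c where "y = x + c *\<^sub>R 1" unfolding trop_equiv_def by blast
  then show "trop_equiv (r *\<^sub>R x) (r *\<^sub>R y)"
    by (intro trop_equivI[where c = "r * c"]) (simp add: scaleR_add_right)
qed

instance
proof
  note refl = equivp_reflp[OF equivp_trop_equiv]
  fix x y z :: "'a tropical_affine" and a b :: real
  show "x + y + z = x + (y + z)" by transfer (simp add: add.assoc refl)
  show "x + y = y + x" by transfer (simp add: add.commute refl)
  show "0 + x = x" by transfer (simp add: refl)
  show "- x + x = 0" by transfer (simp add: refl)
  show "x - y = x + - y" by transfer (simp add: refl)
  show "a *\<^sub>R (x + y) = a *\<^sub>R x + a *\<^sub>R y" by transfer (simp add: scaleR_add_right refl)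
  show "(a + b) *\<^sub>R x = a *\<^sub>R x + b *\<^sub>R x" by transfer (simp add: scaleR_add_left refl)
  show "a *\<^sub>R b *\<^sub>R x = (a * b) *\<^sub>R x" by transfer (simp add: refl)
  show "1 *\<^sub>R x = x" by transfer (simp add: refl)
qed

end


section \<open>Tropical polyhedra and covector cells\<close>

definition point_configuration :: "ereal ^ 'n ^ 'd \<Rightarrow> bool"
  where "point_configuration V \<longleftrightarrow>
    (\<forall>i j. V $ i $ j \<noteq> -\<infinity>) \<and> (\<forall>i. \<exists>j. V $ i $ j \<noteq> \<infinity>) \<and> (\<forall>j. \<exists>i. V $ i $ j \<noteq> \<infinity>)"

text \<open>
  For a point configuration \<open>V\<close> and real \<open>\<lambda>\<close>, all coordinates of \<open>V \<odot> \<lambda>\<close> are finite, so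
  \<open>x\<close> below is \<open>V \<odot> \<lambda>\<close> itself, regarded as a real vector.
\<close>

definition tconv :: "ereal ^ 'n ^ 'd \<Rightarrow> 'd tropical_affine set"
  where "tconv V =
    {trop_proj x | x (l :: real ^ 'n). (\<chi> i. ereal (x $ i)) = V \<odot>v (\<chi> j. ereal (l $ j))}"

text \<open>
  A property of the generators \<open>V\<close> rather than of a set, because the number of columns
  is a type and cannot be quantified existentially.
\<close>

definition generates_polytrope :: "ereal ^ 'n ^ 'd \<Rightarrow> bool"
  where "generates_polytrope V \<longleftrightarrow> point_configuration V \<and> convex (tconv V)"

definition max_form :: "ereal ^ 'd \<Rightarrow> real ^ 'd \<Rightarrow> ereal"
  where "max_form v x = (MAX l\<in>{l. v $ l \<noteq> \<infinity>}. ereal (x $ l) - v $ l)"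

text \<open>
  The defining condition is invariant under adding a multiple of the all-ones vector to \<open>x\<close>.
\<close>

definition closed_cell :: "'d \<Rightarrow> ereal ^ 'd \<Rightarrow> 'd tropical_affine set"
  where "closed_cell i v = {trop_proj x | x. ereal (x $ i) - v $ i = max_form v x}"

definition support_graph :: "ereal ^ 'n ^ 'd \<Rightarrow> ('n \<times> 'd) set"
  where "support_graph V = {(j, i). V $ i $ j \<noteq> \<infinity>}"

definition perfect_matching :: "('n \<times> 'd) set \<Rightarrow> ('n \<times> 'd) set \<Rightarrow> bool"
  where "perfect_matching H M \<longleftrightarrow>
    M \<subseteq> H \<and> (\<forall>j. \<exists>!i. (j, i) \<in> M) \<and> (\<forall>i. \<exists>!j. (j, i) \<in> M)"

definition covector_cell :: "('n \<times> 'd) set \<Rightarrow> ereal ^ 'n ^ 'd \<Rightarrow> 'd tropical_affine set"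
  where "covector_cell L V = (\<Inter>(j, i)\<in>L. closed_cell i (column j V))"

end

theory Submission
  imports Defs
begin

text \<open>
  Both sets are the image in the tropical affine space of the weighted digraph polyhedron
  \<open>Q(C) = {x. \<forall>i j. x\<^sub>i \<le> c\<^sub>i\<^sub>j + x\<^sub>j}\<close>. Since the diagonal of \<open>C\<close> is zero, \<open>x\<^sub>j - c\<^sub>j\<^sub>j\<close> is the maximum
  of the \<open>x\<^sub>l - c\<^sub>l\<^sub>j\<close> exactly when the inequalities with second index \<open>j\<close> hold, so the covector
  cell is \<open>Q(C)\<close>. A point of \<open>Q(C)\<close> is fixed by \<open>C\<close>, hence by every power of \<open>C\<close> and by \<open>C\<^sup>\<star>\<close>,
  which puts it in both tropical convex hulls. Conversely, \<open>C\<^sup>\<star> \<odot> \<lambda>\<close> lies in \<open>Q(C)\<close> because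
  \<open>c\<^sup>\<star>\<^sub>i\<^sub>k \<le> c\<^sub>i\<^sub>j + c\<^sup>\<star>\<^sub>j\<^sub>k\<close>. Acyclicity enters only here: the powers of \<open>C\<close> are stationary in row \<open>i\<close>
  from the exponent \<open>card {j. j < i}\<close> on, so truncating the star at exponent \<open>n - 1\<close> loses nothing.
\<close>

section \<open>Min-plus products, powers and the Kleene star\<close>

lemma trop_mat_mult_le: "(A \<odot> B) $ i $ j \<le> A $ i $ k + B $ k $ j"
  by (auto simp: trop_mat_mult_def intro!: Min_le)

lemma le_trop_mat_mult_iff: "a \<le> (A \<odot> B) $ i $ j \<longleftrightarrow> (\<forall>k. a \<le> A $ i $ k + B $ k $ j)"
  by (simp add: trop_mat_mult_def)

lemma trop_mat_vec_le: "(A \<odot>v x) $ i \<le> A $ i $ j + x $ j"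
  by (auto simp: trop_mat_vec_def intro!: Min_le)

lemma le_trop_mat_vec_iff: "a \<le> (A \<odot>v x) $ i \<longleftrightarrow> (\<forall>j. a \<le> A $ i $ j + x $ j)"
  by (simp add: trop_mat_vec_def)

lemma trop_mat_mult_neq_MInf:
  assumes "\<And>i j. A $ i $ j \<noteq> -\<infinity>" "\<And>i j. B $ i $ j \<noteq> -\<infinity>"
  shows "(A \<odot> B) $ i $ j \<noteq> -\<infinity>"
proof -
  have "(A \<odot> B) $ i $ j \<in> range (\<lambda>k. A $ i $ k + B $ k $ j)"
    unfolding trop_mat_mult_def by (simp only: vec_lambda_beta, rule Min_in) auto
  then obtain k where "(A \<odot> B) $ i $ j = A $ i $ k + B $ k $ j" by blast
  with assms show ?thesis by simp
qed

lemma trop_mat_power_neq_MInf: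
  "(\<And>i j. A $ i $ j \<noteq> -\<infinity>) \<Longrightarrow> trop_mat_power A k $ i $ j \<noteq> -\<infinity>"
  by (induction k arbitrary: i j) (auto simp: trop_id_def trop_mat_mult_neq_MInf)

lemma kleene_star_le:
  fixes A :: "ereal ^ 'n ^ 'n"
  shows "k \<le> CARD('n) - 1 \<Longrightarrow> kleene_star A $ i $ j \<le> trop_mat_power A k $ i $ j"
  by (auto simp: kleene_star_def intro!: Min_le)

lemma kleene_star_attained:
  fixes A :: "ereal ^ 'n ^ 'n"
  obtains k where "k \<le> CARD('n) - 1" "kleene_star A $ i $ j = trop_mat_power A k $ i $ j"
proof -
  have "kleene_star A $ i $ j \<in> (\<lambda>k. trop_mat_power A k $ i $ j) ` {..CARD('n) - 1}"
    unfolding kleene_star_def by (simp only: vec_lambda_beta, rule Min_in) auto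
  then show thesis using that by auto
qed

lemma kleene_star_diag_le: "kleene_star A $ i $ i \<le> 0"
  using kleene_star_le[of 0 A i i] by (simp add: trop_id_def)

lemma point_configuration_kleene_star:
  assumes "\<And>i j. A $ i $ j \<noteq> -\<infinity>"
  shows "point_configuration (kleene_star A)"
proof -
  have "kleene_star A $ i $ j \<noteq> -\<infinity>" for i j
    by (rule kleene_star_attained[of A i j]) (simp add: trop_mat_power_neq_MInf[OF assms])
  moreover have "kleene_star A $ i $ i \<noteq> \<infinity>" for i
    using kleene_star_diag_le[of A i] by auto
  ultimately show ?thesis by (auto simp: point_configuration_def)
qed

section \<open>The weighted digraph polyhedron\<close>

definition digraph_polyhedron :: "ereal ^ 'n ^ 'n \<Rightarrow> (real ^ 'n) set"
  where "digraph_polyhedron A = {x. \<forall>i j. ereal (x $ i) \<le> A $ i $ j + ereal (x $ j)}"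

text \<open>A finite entry cuts out a closed halfspace; an infinite entry gives the whole space or
  the empty set, according to its sign.\<close>

lemma convex_digraph_polyhedron: "convex (digraph_polyhedron A)"
proof -
  have "convex {x :: real ^ 'a. ereal (x $ i) \<le> A $ i $ j + ereal (x $ j)}" for i j
  proof (cases "A $ i $ j")
    case (real r)
    have "x $ i \<le> r + x $ j \<longleftrightarrow> (axis i 1 - axis j 1) \<bullet> x \<le> r" for x :: "real ^ 'a"
      by (auto simp: inner_diff_left inner_axis')
    with real show ?thesis by (simp add: convex_halfspace_le)
  qed auto
  moreover have "digraph_polyhedron A
      = (\<Inter>i. \<Inter>j. {x. ereal (x $ i) \<le> A $ i $ j + ereal (x $ j)})"
    by (auto simp: digraph_polyhedron_def)
  ultimately show ?thesis by (simp add: convex_INT)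
qed

lemma trop_proj_eq_iff: "trop_proj x = trop_proj y \<longleftrightarrow> (\<exists>c. y = x + c *\<^sub>R 1)"
  unfolding trop_equiv_def[symmetric] by transfer simp

lemma linear_trop_proj: "linear trop_proj"
  by (rule linearI; transfer; simp add: equivp_reflp[OF equivp_trop_equiv])

lemma convex_trop_proj_digraph_polyhedron: "convex (trop_proj ` digraph_polyhedron A)"
  by (intro convex_linear_image linear_trop_proj convex_digraph_polyhedron)

text \<open>Chains the defining inequalities along a walk of \<open>k\<close> steps from
  \<open>j\<close> to \<open>i\<close>.\<close>

lemma le_trop_mat_power_mult:
  assumes "x \<in> digraph_polyhedron A"
  shows "ereal (x $ i) \<le> trop_mat_power A k $ i $ j + ereal (x $ j)"
proof (induction k arbitrary: i)
  case 0
  then show ?case by (simp add: trop_id_def)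
next
  case (Suc k)
  have "(A \<odot> trop_mat_power A k) $ i $ j
      \<in> range (\<lambda>l. A $ i $ l + trop_mat_power A k $ l $ j)"
    unfolding trop_mat_mult_def by (simp only: vec_lambda_beta, rule Min_in) auto
  then obtain l where l: "trop_mat_power A (Suc k) $ i $ j = A $ i $ l + trop_mat_power A k $ l $ j"
    by auto
  have "ereal (x $ i) \<le> A $ i $ l + ereal (x $ l)"
    using assms by (simp add: digraph_polyhedron_def)
  also have "\<dots> \<le> A $ i $ l + (trop_mat_power A k $ l $ j + ereal (x $ j))"
    by (intro add_left_mono Suc.IH)
  finally show ?case by (simp only: l add.assoc)
qed

section \<open>Comparison with tropical convex hulls\<close>

lemma digraph_polyhedron_subset_tconv:
  assumes "\<And>i. A $ i $ i \<le> 0"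
  shows "trop_proj ` digraph_polyhedron A \<subseteq> tconv A"
proof
  fix p assume "p \<in> trop_proj ` digraph_polyhedron A"
  then obtain x where p: "p = trop_proj x" and x: "x \<in> digraph_polyhedron A" by blast
  \<comment> \<open>The point \<open>x\<close> serves as its own coefficient vector: the diagonal
    bounds the product above by \<open>x\<close>, the defining inequalities bound it below.\<close>
  let ?x = "\<chi> i. ereal (x $ i)"
  have "(A \<odot>v ?x) $ i \<le> ?x $ i" for i
    using trop_mat_vec_le[of A ?x i i] add_right_mono[OF assms[of i], of "?x $ i"] by simp
  moreover have "?x $ i \<le> (A \<odot>v ?x) $ i" for i
    using x by (simp add: digraph_polyhedron_def le_trop_mat_vec_iff)
  ultimately have "?x = A \<odot>v ?x"
    by (simp only: vec_eq_iff) (metis antisym)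
  then show "p \<in> tconv A" unfolding tconv_def p by blast
qed

lemma digraph_polyhedron_subset_kleene_star:
  "digraph_polyhedron A \<subseteq> digraph_polyhedron (kleene_star A)"
proof
  fix x assume x: "x \<in> digraph_polyhedron A"
  have "ereal (x $ i) \<le> kleene_star A $ i $ j + ereal (x $ j)" for i j
    by (rule kleene_star_attained[of A i j]) (simp add: le_trop_mat_power_mult[OF x])
  then show "x \<in> digraph_polyhedron (kleene_star A)" by (simp add: digraph_polyhedron_def)
qed

text \<open>\<open>B\<close> stands for the Kleene star of \<open>A\<close>. The triangle inequality
  says that the columns of \<open>B\<close> satisfy the inequalities of \<open>A\<close>, and these
  survive adding constants to columns and taking minima.\<close>

lemma tconv_subset_digraph_polyhedron:
  assumes "\<And>i j k. B $ i $ k \<le> A $ i $ j + B $ j $ k"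
  shows "tconv B \<subseteq> trop_proj ` digraph_polyhedron A"
proof
  fix p assume "p \<in> tconv B"
  then obtain x l where p: "p = trop_proj x"
    and x: "(\<chi> i. ereal (x $ i)) = B \<odot>v (\<chi> j. ereal (l $ j))"
    unfolding tconv_def by blast
  let ?l = "\<chi> j. ereal (l $ j)"
  have xi: "ereal (x $ i) = (B \<odot>v ?l) $ i" for i using x by (simp add: vec_eq_iff)
  have "ereal (x $ i) \<le> A $ i $ j + ereal (x $ j)" for i j
  proof -
    \<comment> \<open>The column \<open>k\<close> that attains the minimum in row \<open>j\<close>
      also bounds row \<open>i\<close>.\<close>
    have "(B \<odot>v ?l) $ j \<in> range (\<lambda>k. B $ j $ k + ?l $ k)"
      unfolding trop_mat_vec_def by (simp only: vec_lambda_beta, rule Min_in) auto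
    then obtain k where k: "ereal (x $ j) = B $ j $ k + ?l $ k" unfolding xi by blast
    have "ereal (x $ i) \<le> B $ i $ k + ?l $ k" unfolding xi by (rule trop_mat_vec_le)
    also have "\<dots> \<le> (A $ i $ j + B $ j $ k) + ?l $ k" by (intro add_right_mono assms)
    also have "\<dots> = A $ i $ j + ereal (x $ j)" by (simp only: k add.assoc)
    finally show ?thesis .
  qed
  then show "p \<in> trop_proj ` digraph_polyhedron A"
    unfolding p digraph_polyhedron_def by blast
qed

section \<open>Stationarity of powers under a topological labeling\<close>

lemma trop_mat_power_antimono:
  assumes "\<And>i. A $ i $ i \<le> 0" and "m \<le> k"
  shows "trop_mat_power A k $ i $ j \<le> trop_mat_power A m $ i $ j"
  using \<open>m \<le> k\<close>
proof (induction k rule: dec_induct)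
  case (step k)
  \<comment> \<open>A walk may idle at \<open>i\<close> for one step without raising its
    weight.\<close>
  have "trop_mat_power A (Suc k) $ i $ j \<le> A $ i $ i + trop_mat_power A k $ i $ j"
    using trop_mat_mult_le by simp
  also have "\<dots> \<le> 0 + trop_mat_power A k $ i $ j" by (intro add_right_mono assms)
  finally show ?case using step.IH by simp
qed simp

text \<open>Apart from idling, a walk of finite weight ending at \<open>i\<close> only passes
  through strictly decreasing labels when read backwards from \<open>i\<close>, so it has at most
  \<open>card {l. l < i}\<close> proper steps.\<close>

lemma trop_mat_power_stationary:
  fixes A :: "ereal ^ 'n::{finite,linorder} ^ 'n::{finite,linorder}"
  assumes diag: "\<And>i. A $ i $ i = 0" and upper: "\<And>i j. i < j \<Longrightarrow> A $ i $ j = \<infinity>"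
    and fin: "\<And>i j. A $ i $ j \<noteq> -\<infinity>"
  shows "trop_mat_power A (card {l. l < i}) $ i $ k \<le> trop_mat_power A m $ i $ k"
proof (induction m arbitrary: i)
  case 0
  show ?case by (rule trop_mat_power_antimono) (auto simp: diag)
next
  case (Suc m)
  have "trop_mat_power A (card {l. l < i}) $ i $ k \<le> A $ i $ j + trop_mat_power A m $ j $ k" for j
  proof (cases i j rule: linorder_cases)
    case equal
    then show ?thesis using Suc.IH[of i] by (simp add: diag)
  next
    case less
    then show ?thesis using upper trop_mat_power_neq_MInf[OF fin] by simp
  next
    case greater
    \<comment> \<open>The strict inequality leaves room for the extra factor that carries the step
      from \<open>j\<close> to \<open>i\<close>.\<close>
    have "card {l. l < j} < card {l. l < i}"
      using greater by (intro psubset_card_mono) auto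
    then have "trop_mat_power A (card {l. l < i}) $ i $ k
        \<le> trop_mat_power A (Suc (card {l. l < j})) $ i $ k"
      by (intro trop_mat_power_antimono) (auto simp: diag)
    also have "\<dots> \<le> A $ i $ j + trop_mat_power A (card {l. l < j}) $ j $ k"
      using trop_mat_mult_le by simp
    also have "\<dots> \<le> A $ i $ j + trop_mat_power A m $ j $ k"
      by (intro add_left_mono Suc.IH)
    finally show ?thesis .
  qed
  then show ?case by (simp add: le_trop_mat_mult_iff)
qed

lemma kleene_star_triangle:
  fixes A :: "ereal ^ 'n::{finite,linorder} ^ 'n::{finite,linorder}"
  assumes "\<And>i. A $ i $ i = 0" "\<And>i j. i < j \<Longrightarrow> A $ i $ j = \<infinity>" "\<And>i j. A $ i $ j \<noteq> -\<infinity>"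
  shows "kleene_star A $ i $ k \<le> A $ i $ j + kleene_star A $ j $ k"
proof -
  obtain m where m: "kleene_star A $ j $ k = trop_mat_power A m $ j $ k"
    by (rule kleene_star_attained)
  \<comment> \<open>The node \<open>i\<close> is not below itself, so the stationary exponent is at
    most \<open>CARD('n) - 1\<close>, the truncation of the star.\<close>
  have "card {l. l < i} < CARD('n)" by (intro psubset_card_mono) auto
  then have "kleene_star A $ i $ k \<le> trop_mat_power A (card {l. l < i}) $ i $ k"
    by (intro kleene_star_le) simp
  also have "\<dots> \<le> trop_mat_power A (Suc m) $ i $ k"
    by (rule trop_mat_power_stationary[OF assms])
  also have "\<dots> \<le> A $ i $ j + trop_mat_power A m $ j $ k"
    using trop_mat_mult_le by simp
  finally show ?thesis by (simp only: m)
qed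

section \<open>Covector cells as digraph polyhedra\<close>

lemma max_form_eq_iff:
  assumes "v $ i \<noteq> \<infinity>"
  shows "ereal (x $ i) - v $ i = max_form v x
    \<longleftrightarrow> (\<forall>l. v $ l \<noteq> \<infinity> \<longrightarrow> ereal (x $ l) - v $ l \<le> ereal (x $ i) - v $ i)"
  unfolding max_form_def using assms by (subst eq_Max_iff) auto

lemma max_form_diag_eq_iff:
  assumes "A $ j $ j = 0"
  shows "ereal (x $ j) - column j A $ j = max_form (column j A) x
    \<longleftrightarrow> (\<forall>i. ereal (x $ i) \<le> A $ i $ j + ereal (x $ j))"
proof -
  \<comment> \<open>At an infinite entry outside the support the right side holds trivially, so the
    restriction to the support disappears.\<close>
  have "(A $ i $ j \<noteq> \<infinity> \<longrightarrow> ereal (x $ i) - A $ i $ j \<le> ereal (x $ j))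
      \<longleftrightarrow> ereal (x $ i) \<le> A $ i $ j + ereal (x $ j)" for i
    by (cases "A $ i $ j") auto
  with assms show ?thesis by (subst max_form_eq_iff) (auto simp: column_def)
qed

lemma INT_closed_cell_diag:
  assumes "\<And>j. A $ j $ j = 0"
  shows "(\<Inter>j. closed_cell j (column j A)) = trop_proj ` digraph_polyhedron A"
proof -
  have cell: "closed_cell j (column j A)
      = trop_proj ` {x. \<forall>i. ereal (x $ i) \<le> A $ i $ j + ereal (x $ j)}" for j
    unfolding closed_cell_def max_form_diag_eq_iff[OF assms] by blast
  \<comment> \<open>An intersection of images need not be the image of the intersection, since each
    cell could use its own representative. Translation invariance lets one representative serve
    every \<open>j\<close>.\<close>
  have shift: "(\<forall>i. ereal ((x + c *\<^sub>R 1) $ i) \<le> A $ i $ j + ereal ((x + c *\<^sub>R 1) $ j))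
      \<longleftrightarrow> (\<forall>i. ereal (x $ i) \<le> A $ i $ j + ereal (x $ j))" for x c j
  proof -
    have "ereal (x $ i + c) \<le> A $ i $ j + ereal (x $ j + c)
        \<longleftrightarrow> ereal (x $ i) \<le> A $ i $ j + ereal (x $ j)" for i
      by (cases "A $ i $ j") auto
    then show ?thesis by simp
  qed
  have mem: "trop_proj x \<in> closed_cell j (column j A)
      \<longleftrightarrow> (\<forall>i. ereal (x $ i) \<le> A $ i $ j + ereal (x $ j))" for x j
  proof
    assume "trop_proj x \<in> closed_cell j (column j A)"
    then obtain y where "trop_proj x = trop_proj y"
      and y: "\<forall>i. ereal (y $ i) \<le> A $ i $ j + ereal (y $ j)"
      unfolding cell by blast
    then obtain c where "y = x + c *\<^sub>R 1" by (auto simp: trop_proj_eq_iff)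
    with y show "\<forall>i. ereal (x $ i) \<le> A $ i $ j + ereal (x $ j)" using shift by blast
  qed (unfold cell, blast)
  have surj: "\<exists>x. p = trop_proj x" for p :: "'a tropical_affine"
    by transfer (auto intro: equivp_reflp[OF equivp_trop_equiv])
  show ?thesis
  proof (intro set_eqI iffI)
    fix p assume p: "p \<in> (\<Inter>j. closed_cell j (column j A))"
    obtain x where x: "p = trop_proj x" using surj by blast
    from p have "x \<in> digraph_polyhedron A" by (simp add: x mem digraph_polyhedron_def)
    then show "p \<in> trop_proj ` digraph_polyhedron A" by (simp add: x)
  next
    fix p assume "p \<in> trop_proj ` digraph_polyhedron A"
    then show "p \<in> (\<Inter>j. closed_cell j (column j A))"
      by (auto simp: mem digraph_polyhedron_def)
  qed
qed

theorem theorem3p5: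
  fixes E :: "('n::{finite,linorder} \<times> 'n) set" and w :: "'n \<times> 'n \<Rightarrow> real"
    and C :: "ereal ^ 'n::{finite,linorder} ^ 'n::{finite,linorder}" and L :: "('n \<times> 'n) set"
  assumes "acyclic E"
    and "\<And>j i. (j, i) \<in> E \<Longrightarrow> j < i"
    and "C = weighted_adjacency E w"
    and "L = {(j, j) | j. True}"
  shows "perfect_matching (support_graph C) L
    \<and> tconv (kleene_star C) \<subseteq> tconv C
    \<and> generates_polytrope (kleene_star C)
    \<and> tconv (kleene_star C) = covector_cell L C
    \<and> covector_cell L C = (\<Inter>j. closed_cell j (column j C))"
proof -
  \<comment> \<open>\<open>weighted_adjacency\<close> tests for an edge before the diagonal; the
    labeling rules out loops, so the 0 is reached.\<close>
  have diag: "C $ i $ i = 0" for i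
    using assms(2)[of i i] by (auto simp: assms(3) weighted_adjacency_def)
  have upper: "C $ i $ j = \<infinity>" if "i < j" for i j
    using assms(2)[of j i] that by (auto simp: assms(3) weighted_adjacency_def)
  have fin: "C $ i $ j \<noteq> -\<infinity>" for i j
    by (auto simp: assms(3) weighted_adjacency_def)
  have cells: "covector_cell L C = (\<Inter>j. closed_cell j (column j C))"
    by (auto simp: covector_cell_def assms(4))
  have "tconv (kleene_star C) \<subseteq> trop_proj ` digraph_polyhedron C"
    by (intro tconv_subset_digraph_polyhedron kleene_star_triangle diag upper fin)
  moreover have "trop_proj ` digraph_polyhedron C \<subseteq> tconv (kleene_star C)"
    \<comment> \<open>The self-coefficient argument is applied with the star in place of
      \<open>C\<close>.\<close>
    using digraph_polyhedron_subset_tconv[OF kleene_star_diag_le]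
      digraph_polyhedron_subset_kleene_star by blast
  ultimately have star: "tconv (kleene_star C) = trop_proj ` digraph_polyhedron C" ..
  have "perfect_matching (support_graph C) L"
    by (auto simp: perfect_matching_def support_graph_def assms(4) diag)
  moreover have "tconv (kleene_star C) \<subseteq> tconv C"
    unfolding star by (rule digraph_polyhedron_subset_tconv) (simp add: diag)
  moreover have "generates_polytrope (kleene_star C)"
    unfolding generates_polytrope_def star
    using point_configuration_kleene_star[OF fin] convex_trop_proj_digraph_polyhedron by blast
  ultimately show ?thesis
    using cells star INT_closed_cell_diag[OF diag] by simp
qed

end
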